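(* Let $a>0$ and $\alpha\in(0,1)$ be arbitrary, and put $\alpha'=\sqrt{1-\alpha^2}$. Then the implicit equation $$\operatorname{sn}\left(\frac{az}{\alpha'};\alpha\right)=\frac{\cos ax}{\cosh ay},\qquad |z|\le \frac{\alpha'}{a}\,\mathrm{K}(\alpha),$$ defines a function $z=u_{a,\alpha}(x,y)$ on $\mathbb{R}^2$ which is real analytic everywhere in $\mathbb{R}^2$ outside the set of points $$\Sigma=\left\{(x,y):\ x=\frac{\pi k}{a},\ y=0,\ k\in\mathbb{Z}\right\},$$ and on $\mathbb{R}^2\setminus\Sigma$ it is a space-like solution of $$(1-u_y^2)u_{xx}+2u_xu_yu_{xy}+(1-u_x^2)u_{yy}=0 .$$
   Context: Space-like means $|\nabla u(x,y)|<1$. $\operatorname{sn}(t;k)$ is the Jacobi elliptic sine with modulus $k$, defined by $\int_0^{\operatorname{sn}(t;k)}\frac{ds}{\sqrt{(1-s^2)(1-k^2s^2)}}=t$ (for $|t|\le \mathrm{K}(k)$, and extended as usual), and $\mathrm{K}(k)$ is the complete elliptic integral of the first kind, i.e. the least positive solution of $\operatorname{sn}(\mathrm{K}(k);k)=1$. *)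

theory Defs
  imports "HOL-Analysis.Analysis"
begin

section \<open>Legendre's elliptic integral of the first kind and the Jacobi function sn\<close>

text \<open>The second parameter is the modulus \<open>k\<close>, not the parameter \<open>m = k\<^sup>2\<close>.  The definitions are
  meaningful for \<open>0 \<le> k < 1\<close> and \<open>\<bar>w\<bar> \<le> 1\<close>; the integral is signed, so it is odd in \<open>w\<close>.\<close>

definition elliptic_F :: "real \<Rightarrow> real \<Rightarrow> real" where
  "elliptic_F w k = (LBINT s=0..w. 1 / sqrt ((1 - s\<^sup>2) * (1 - k\<^sup>2 * s\<^sup>2)))"

definition elliptic_K :: "real \<Rightarrow> real" where
  "elliptic_K k = elliptic_F 1 k"

text \<open>The branch on \<open>\<bar>t\<bar> \<le> elliptic_K k\<close>, where sn is the inverse of the elliptic integral.\<close>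

definition jacobi_sn_branch :: "real \<Rightarrow> real \<Rightarrow> real" where
  "jacobi_sn_branch t k = (THE w. \<bar>w\<bar> \<le> 1 \<and> elliptic_F w k = t)"

text \<open>The extension to the real line is determined by \<open>sn (t + 2 K) = - sn t\<close>.\<close>

definition jacobi_sn :: "real \<Rightarrow> real \<Rightarrow> real" where
  "jacobi_sn t k = (let n = round (t / (2 * elliptic_K k))
     in (-1) powi n * jacobi_sn_branch (t - 2 * of_int n * elliptic_K k) k)"

text \<open>The facts below show that these definitions agree with the usual description:
  \<open>elliptic_F \<sdot> k\<close> is a bijection from \<open>[-1, 1]\<close> onto \<open>[-K, K]\<close> and \<open>jacobi_sn\<close> inverts it on that
  interval, and \<open>elliptic_K k\<close> is the least positive \<open>t\<close> with \<open>sn t = 1\<close>.\<close>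

context
  fixes k :: real
  assumes k: "0 \<le> k" "k < 1"
begin

private definition g :: "real \<Rightarrow> real" where
  "g s = 1 / sqrt ((1 - s\<^sup>2) * (1 - k\<^sup>2 * s\<^sup>2))"

private lemma k2: "k\<^sup>2 < 1"
  using k by (simp add: power_less_one_iff)

private lemma g_bounds:
  assumes "\<bar>s\<bar> < 1"
  shows "1 \<le> g s" "g s \<le> (1 / sqrt (1 - k\<^sup>2)) * (1 / sqrt (1 - s\<^sup>2))"
proof -
  have s: "0 \<le> s\<^sup>2" "s\<^sup>2 < 1" using assms by (auto simp: abs_square_less_1)
  have ks: "k\<^sup>2 * s\<^sup>2 \<le> k\<^sup>2" using s mult_left_le[of "s\<^sup>2" "k\<^sup>2"] by simp
  have pos: "0 < (1 - s\<^sup>2) * (1 - k\<^sup>2 * s\<^sup>2)" using s ks k2 by (intro mult_pos_pos) auto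
  have "(1 - s\<^sup>2) * (1 - k\<^sup>2 * s\<^sup>2) \<le> 1 * 1"
    using s ks k2 by (intro mult_mono) auto
  then have "sqrt ((1 - s\<^sup>2) * (1 - k\<^sup>2 * s\<^sup>2)) \<le> 1" by simp
  then show "1 \<le> g s" using pos unfolding g_def by (simp add: field_simps)
  have "(1 - s\<^sup>2) * (1 - k\<^sup>2) \<le> (1 - s\<^sup>2) * (1 - k\<^sup>2 * s\<^sup>2)"
    using s ks by (intro mult_left_mono) auto
  then have "g s \<le> 1 / sqrt ((1 - s\<^sup>2) * (1 - k\<^sup>2))"
    unfolding g_def using s k2 by (intro divide_left_mono) (auto intro!: mult_pos_pos pos)
  also have "\<dots> = (1 / sqrt (1 - k\<^sup>2)) * (1 / sqrt (1 - s\<^sup>2))"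
    by (simp add: real_sqrt_mult)
  finally show "g s \<le> (1 / sqrt (1 - k\<^sup>2)) * (1 / sqrt (1 - s\<^sup>2))" .
qed

private lemma arcsin_integrable: "set_integrable lborel {-1<..<1::real} (\<lambda>s. 1 / sqrt (1 - s\<^sup>2))"
proof -
  have "set_integrable lborel (einterval (ereal (-1)) (ereal 1)) (\<lambda>s. 1 / sqrt (1 - s\<^sup>2))"
  proof (rule interval_integral_FTC_nonneg(1))
    show "DERIV arcsin x :> 1 / sqrt (1 - x\<^sup>2)" if "ereal (-1) < ereal x" "ereal x < ereal 1" for x
      using DERIV_arcsin[of x] that by (simp add: inverse_eq_divide)
    show "isCont (\<lambda>s. 1 / sqrt (1 - s\<^sup>2)) x" if "ereal (-1) < ereal x" "ereal x < ereal 1" for x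
    proof -
      have "x\<^sup>2 < 1" using that by (auto simp: abs_square_less_1)
      then show ?thesis by (intro continuous_intros) auto
    qed
    show "AE x in lborel. ereal (-1) < ereal x \<longrightarrow> ereal x < ereal 1 \<longrightarrow> 0 \<le> 1 / sqrt (1 - x\<^sup>2)"
      by (auto intro!: AE_I2 simp: abs_square_le_1)
    have c: "continuous_on {-1..1} arcsin" by (rule continuous_on_arcsin')
    have "((\<lambda>x. arcsin x) \<longlongrightarrow> arcsin (-1)) (at (-1) within {-1..1})"
      using c unfolding continuous_on_def by (rule bspec) simp
    then show "((arcsin \<circ> real_of_ereal) \<longlongrightarrow> arcsin (-1)) (at_right (ereal (-1)))"
      by (simp add: ereal_tendsto_simps1 at_within_Icc_at_right)
    have "((\<lambda>x. arcsin x) \<longlongrightarrow> arcsin 1) (at 1 within {-1..1})"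
      using c unfolding continuous_on_def by (rule bspec) simp
    then show "((arcsin \<circ> real_of_ereal) \<longlongrightarrow> arcsin 1) (at_left (ereal 1))"
      by (simp add: ereal_tendsto_simps1 at_within_Icc_at_left)
  qed simp
  then show ?thesis by simp
qed

private lemma g_integrable: "set_integrable lborel {-1<..<1} g"
proof (rule set_integrable_bound)
  show "set_integrable lborel {-1<..<1} (\<lambda>s. (1 / sqrt (1 - k\<^sup>2)) * (1 / sqrt (1 - s\<^sup>2)))"
    using arcsin_integrable by (rule set_integrable_mult_right)
  show "set_borel_measurable lborel {-1<..<1} g"
    unfolding g_def set_borel_measurable_def by measurable
  show "AE x in lborel. x \<in> {-1<..<1} \<longrightarrow>
      norm (g x) \<le> norm ((1 / sqrt (1 - k\<^sup>2)) * (1 / sqrt (1 - x\<^sup>2)))"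
  proof (intro AE_I2 impI)
    fix x :: real assume "x \<in> {-1<..<1}"
    then have "\<bar>x\<bar> < 1" by auto
    from g_bounds[OF this] show "norm (g x) \<le> norm ((1 / sqrt (1 - k\<^sup>2)) * (1 / sqrt (1 - x\<^sup>2)))"
      by (simp only: real_norm_def)
  qed
qed

private lemma g_interval_integrable:
  assumes "-1 \<le> v" "v \<le> w" "w \<le> (1::real)"
  shows "interval_lebesgue_integrable lborel v w g" "set_integrable lborel {v<..<w} g"
proof -
  show "set_integrable lborel {v<..<w} g"
    by (rule set_integrable_subset[OF g_integrable]) (use assms in auto)
  then show "interval_lebesgue_integrable lborel v w g"
    using assms by (simp add: interval_lebesgue_integrable_def)
qed

private lemma elliptic_F_diff:
  assumes "-1 \<le> v" "v \<le> w" "w \<le> 1"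
  shows "elliptic_F w k - elliptic_F v k = (LBINT s=v..w. g s)"
proof -
  have "interval_lebesgue_integrable lborel (ereal (min 0 (min v w))) (ereal (max 0 (max v w))) g"
    using assms by (intro g_interval_integrable) auto
  then have "(LBINT s=ereal 0..ereal v. g s) + (LBINT s=v..w. g s) = (LBINT s=ereal 0..ereal w. g s)"
    by (intro interval_integral_sum) simp
  then show ?thesis by (simp add: elliptic_F_def g_def zero_ereal_def)
qed

private lemma elliptic_F_mono_diff:
  assumes "-1 \<le> v" "v \<le> w" "w \<le> 1"
  shows "w - v \<le> elliptic_F w k - elliptic_F v k"
proof -
  have "(LBINT s=v..w. (1::real)) \<le> (LBINT s=v..w. g s)"
    unfolding interval_lebesgue_integral_def using assms g_bounds g_interval_integrable(2)[OF assms]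
      interval_integral_const(1)[of v w "1::real"]
    by (auto intro!: set_integral_mono simp: interval_lebesgue_integrable_def)
  then show ?thesis using elliptic_F_diff[OF assms] by simp
qed

private lemma elliptic_F_continuous: "continuous_on {-1..1} (\<lambda>w. elliptic_F w k)"
proof -
  have i: "set_integrable lborel {-1..1} g"
    by (rule iffD1[OF set_integrable_discrete_difference[of "{-1,1}" "{-1<..<1}" "{-1..1}"]])
       (use g_integrable in auto)
  have eq: "elliptic_F w k = integral {-1..w} g + elliptic_F (-1) k" if "w \<in> {-1..1}" for w
  proof -
    have "set_integrable lborel {-1..w} g"
      by (rule set_integrable_subset[OF i]) (use that in auto)
    then have "(LBINT s=ereal (-1)..ereal w. g s) = integral {-1..w} g"
      using that by (intro interval_integral_eq_integral) auto
    with elliptic_F_diff[of "-1" w] that show ?thesis by simp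
  qed
  have "continuous_on {-1..1} (\<lambda>w. integral {-1..w} g + elliptic_F (-1) k)"
    by (intro continuous_intros indefinite_integral_continuous_1 set_borel_integral_eq_integral(1) i)
  then show ?thesis using eq by (metis (no_types, lifting) continuous_on_cong)
qed

lemma elliptic_F_minus: "elliptic_F (- w) k = - elliptic_F w k"
  unfolding elliptic_F_def
  by (subst interval_integral_reflect) (simp add: interval_integral_endpoints_reverse[of _ 0])

lemma elliptic_F_0: "elliptic_F 0 k = 0"
  unfolding elliptic_F_def by (simp flip: zero_ereal_def)

lemma elliptic_K_ge_1: "1 \<le> elliptic_K k"
  using elliptic_F_mono_diff[of 0 1] by (simp add: elliptic_K_def elliptic_F_0)

lemma elliptic_F_strict_mono:
  assumes "-1 \<le> v" "v < w" "w \<le> 1"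
  shows "elliptic_F v k < elliptic_F w k"
  using elliptic_F_mono_diff[of v w] assms by simp

lemma elliptic_F_surj:
  assumes "\<bar>t\<bar> \<le> elliptic_K k"
  shows "\<exists>!w. \<bar>w\<bar> \<le> 1 \<and> elliptic_F w k = t"
proof -
  have "\<exists>w\<ge>-1. w \<le> 1 \<and> elliptic_F w k = t"
    using assms elliptic_F_minus[of 1]
    by (intro IVT' elliptic_F_continuous) (auto simp: elliptic_K_def)
  moreover have "v = w" if "\<bar>v\<bar> \<le> 1" "\<bar>w\<bar> \<le> 1" "elliptic_F v k = elliptic_F w k" for v w
    using elliptic_F_strict_mono[of v w] elliptic_F_strict_mono[of w v] that by linarith
  ultimately show ?thesis
    by (smt (verit, best))
qed

lemma jacobi_sn_branch_iff:
  assumes "\<bar>t\<bar> \<le> elliptic_K k"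
  shows "jacobi_sn_branch t k = w \<longleftrightarrow> \<bar>w\<bar> \<le> 1 \<and> elliptic_F w k = t"
  using theI'[OF elliptic_F_surj[OF assms]] elliptic_F_surj[OF assms]
  unfolding jacobi_sn_branch_def by blast

lemma jacobi_sn_plus_2K: "jacobi_sn (t + 2 * elliptic_K k) k = - jacobi_sn t k"
proof -
  have "round ((t + 2 * elliptic_K k) / (2 * elliptic_K k)) = round (t / (2 * elliptic_K k)) + 1"
  proof -
    have "(t + 2 * elliptic_K k) / (2 * elliptic_K k) = t / (2 * elliptic_K k) + 1"
      using elliptic_K_ge_1 by (simp add: field_simps)
    then have *: "(t + 2 * elliptic_K k) / (2 * elliptic_K k) + 1 / 2 = (t / (2 * elliptic_K k) + 1 / 2) + 1"
      by simp
    show ?thesis unfolding round_def * by (rule one_add_floor[symmetric])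
  qed
  then show ?thesis
    unfolding jacobi_sn_def Let_def by (simp add: power_int_add algebra_simps)
qed

lemma jacobi_sn_iff:
  assumes "\<bar>t\<bar> \<le> elliptic_K k"
  shows "jacobi_sn t k = w \<longleftrightarrow> \<bar>w\<bar> \<le> 1 \<and> elliptic_F w k = t"
proof (cases "t = elliptic_K k")
  case True
  have r: "round (t / (2 * elliptic_K k)) = 1"
    using True elliptic_K_ge_1 by (simp add: round_def)
  have "jacobi_sn_branch (- elliptic_K k) k = - 1"
    using elliptic_K_ge_1 elliptic_F_minus[of 1]
    by (subst jacobi_sn_branch_iff) (auto simp: elliptic_K_def)
  then have "jacobi_sn t k = 1" unfolding jacobi_sn_def Let_def r by (simp add: True)
  moreover have "jacobi_sn_branch t k = 1"
    using True elliptic_K_ge_1 by (subst jacobi_sn_branch_iff) (auto simp: elliptic_K_def)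
  ultimately show ?thesis using jacobi_sn_branch_iff[OF assms, of w] by simp
next
  case False
  have "round (t / (2 * elliptic_K k)) = 0"
    unfolding round_def using False assms elliptic_K_ge_1
    by (intro floor_unique) (auto simp: field_simps)
  then show ?thesis unfolding jacobi_sn_def Let_def by (simp add: jacobi_sn_branch_iff[OF assms])
qed

lemma elliptic_K_least:
  "0 < elliptic_K k" "jacobi_sn (elliptic_K k) k = 1"
  "0 < t \<Longrightarrow> jacobi_sn t k = 1 \<Longrightarrow> elliptic_K k \<le> t"
proof -
  show "0 < elliptic_K k" using elliptic_K_ge_1 by simp
  show "jacobi_sn (elliptic_K k) k = 1"
    using elliptic_K_ge_1 by (subst jacobi_sn_iff) (auto simp: elliptic_K_def)
  show "elliptic_K k \<le> t" if "0 < t" "jacobi_sn t k = 1"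
    using jacobi_sn_iff[of t 1] that by (fastforce simp: elliptic_K_def)
qed

end


section \<open>Real analytic functions and partial derivatives in the plane\<close>

text \<open>\<open>has_sum\<close> is unconditional convergence of the double power series, which for real terms is
  absolute convergence.\<close>

definition real_analytic_at :: "(real \<times> real \<Rightarrow> real) \<Rightarrow> real \<times> real \<Rightarrow> bool" where
  "real_analytic_at f p \<longleftrightarrow>
     (\<exists>(c :: nat \<Rightarrow> nat \<Rightarrow> real) r. 0 < r \<and>
        (\<forall>q \<in> ball p r.
           ((\<lambda>(m, n). c m n * (fst q - fst p) ^ m * (snd q - snd p) ^ n) has_sum f q) UNIV))"

definition real_analytic_on :: "(real \<times> real \<Rightarrow> real) \<Rightarrow> (real \<times> real) set \<Rightarrow> bool" where
  "real_analytic_on f S \<longleftrightarrow> (\<forall>p\<in>S. real_analytic_at f p)"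

definition partial_x :: "(real \<times> real \<Rightarrow> real) \<Rightarrow> real \<times> real \<Rightarrow> real" where
  "partial_x u = (\<lambda>(x, y). deriv (\<lambda>s. u (s, y)) x)"

definition partial_y :: "(real \<times> real \<Rightarrow> real) \<Rightarrow> real \<times> real \<Rightarrow> real" where
  "partial_y u = (\<lambda>(x, y). deriv (\<lambda>s. u (x, s)) y)"

definition space_like_at :: "(real \<times> real \<Rightarrow> real) \<Rightarrow> real \<times> real \<Rightarrow> bool" where
  "space_like_at u p \<longleftrightarrow> norm (partial_x u p, partial_y u p) < 1"

definition maximal_surface_eq_at :: "(real \<times> real \<Rightarrow> real) \<Rightarrow> real \<times> real \<Rightarrow> bool" where
  "maximal_surface_eq_at u p \<longleftrightarrow>
     (1 - (partial_y u p)\<^sup>2) * partial_x (partial_x u) p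
     + 2 * partial_x u p * partial_y u p * partial_y (partial_x u) p
     + (1 - (partial_x u p)\<^sup>2) * partial_y (partial_y u) p = 0"

definition singular_set :: "real \<Rightarrow> (real \<times> real) set" where
  "singular_set a = {(x, y). (\<exists>k::int. x = pi * of_int k / a) \<and> y = 0}"

end

theory Submission
  imports Defs "HOL-Complex_Analysis.Complex_Analysis"
begin

text \<open>Solving the equation gives \<open>u = (\<alpha>'/a) F(w)\<close> with \<open>w = cos ax / cosh ay\<close> and \<open>F\<close> the elliptic
  integral, and \<open>\<bar>w\<bar> < 1\<close> exactly off the singular set.  There \<open>F'(w)\<close> is algebraic in \<open>cos ax\<close> and
  \<open>cosh ay\<close>: with \<open>A = cosh\<^sup>2 ay - cos\<^sup>2 ax\<close> and \<open>B = cosh\<^sup>2 ay - \<alpha>\<^sup>2 cos\<^sup>2 ax\<close> one finds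
  \<open>u\<^sub>x = - \<alpha>' sin ax cosh ay / sqrt (A B)\<close> and \<open>u\<^sub>y = - \<alpha>' cos ax sinh ay / sqrt (A B)\<close>.  Hence
  \<open>\<bar>\<nabla>u\<bar>\<^sup>2 = (1 - \<alpha>\<^sup>2) / B < 1\<close>, and the differential equation becomes a polynomial identity in
  \<open>cos\<^sup>2 ax\<close>, \<open>cosh\<^sup>2 ay\<close> and \<open>\<alpha>\<^sup>2\<close>.  For analyticity, the power series of \<open>F\<close> at \<open>0\<close> has radius of
  convergence at least \<open>1\<close>, and on a small square the absolute coefficients of \<open>w\<close> still sum to less
  than \<open>1\<close>, so the series of \<open>F\<close> can be composed with that of \<open>w\<close> and rearranged.\<close>

subsection \<open>Majorised power series in two variables\<close>

text \<open>\<open>M\<close> bounds a weighted \<open>\<ell>\<^sup>1\<close> norm of the coefficients rather than the supremum of \<open>f\<close>: this norm is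
  submultiplicative and gives absolute convergence of compositions.\<close>

definition power_series_bound :: "real \<Rightarrow> (real \<Rightarrow> real \<Rightarrow> real) \<Rightarrow> real \<Rightarrow> bool" where
  "power_series_bound \<rho> f M \<longleftrightarrow>
     (\<exists>c :: nat \<times> nat \<Rightarrow> real. \<exists>M'\<le>M.
        ((\<lambda>p. \<bar>c p\<bar> * \<rho> ^ (fst p + snd p)) has_sum M') UNIV \<and>
        (\<forall>s t. \<bar>s\<bar> \<le> \<rho> \<longrightarrow> \<bar>t\<bar> \<le> \<rho> \<longrightarrow>
           ((\<lambda>p. c p * s ^ fst p * t ^ snd p) has_sum f s t) UNIV))"

section \<open>Absolute convergence and regrouping of families of monomials\<close>

lemma abs_monomial_le:
  fixes s t \<rho> :: real
  assumes "\<bar>s\<bar> \<le> \<rho>" "\<bar>t\<bar> \<le> \<rho>"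
  shows "\<bar>c * s ^ m * t ^ n\<bar> \<le> \<bar>c\<bar> * \<rho> ^ (m + n)"
proof -
  have "\<bar>s\<bar> ^ m * \<bar>t\<bar> ^ n \<le> \<rho> ^ m * \<rho> ^ n"
    using assms by (intro mult_mono power_mono) auto
  then show ?thesis
    by (simp add: abs_mult power_abs power_add mult_left_mono mult.assoc)
qed

lemma summable_on_majorant:
  fixes f :: "'i \<Rightarrow> real"
  assumes "(W has_sum S) A" "\<And>i. i \<in> A \<Longrightarrow> \<bar>f i\<bar> \<le> W i"
  shows "f summable_on A"
proof -
  have "(\<lambda>i. \<bar>f i\<bar>) summable_on A"
    by (rule summable_on_comparison_test[where f = W])
       (use assms in \<open>auto simp: summable_on_def\<close>)
  then show ?thesis using abs_summable_summable[of f A] by simp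
qed

text \<open>The graph of \<open>h\<close> identifies the index set with the disjoint union of the
  fibres of \<open>h\<close>, and an unconditional sum may be taken fibre by fibre.\<close>

lemma has_sum_fibres:
  fixes h :: "'i \<Rightarrow> 'p" and f :: "'i \<Rightarrow> real"
  assumes "(f has_sum S) UNIV" "\<And>p. (f has_sum g p) {i. h i = p}"
  shows "(g has_sum S) UNIV"
proof -
  have "bij_betw snd (SIGMA p:UNIV. {i. h i = p}) UNIV"
    by (rule bij_betwI[of _ _ _ "\<lambda>i. (h i, i)"]) auto
  then have "((\<lambda>z. f (snd z)) has_sum S) (SIGMA p:UNIV. {i. h i = p})"
    using assms(1) by (simp add: has_sum_reindex_bij_betw)
  then show ?thesis
    by (rule has_sum_SigmaD) (use assms(2) in simp)
qed

text \<open>Rearranging a family of monomials by degree only decreases the majorant; so products and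
  infinite sums of power series need no explicit formula for the coefficients.\<close>

lemma power_series_boundI:
  fixes T :: "'i \<Rightarrow> real" and d :: "'i \<Rightarrow> nat \<times> nat"
  assumes "0 < \<rho>"
    and T: "((\<lambda>i. \<bar>T i\<bar> * \<rho> ^ (fst (d i) + snd (d i))) has_sum M') UNIV" and "M' \<le> M"
    and f: "\<And>s t. \<bar>s\<bar> \<le> \<rho> \<Longrightarrow> \<bar>t\<bar> \<le> \<rho> \<Longrightarrow>
              ((\<lambda>i. T i * s ^ fst (d i) * t ^ snd (d i)) has_sum f s t) UNIV"
  shows "power_series_bound \<rho> f M"
proof -
  define I where "I p = {i. d i = p}" for p
  define c where "c p = infsum T (I p)" for p
  have w: "(\<lambda>i. \<bar>T i\<bar> * \<rho> ^ (fst p + snd p)) summable_on I p" for p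
  proof -
    have "(\<lambda>i. \<bar>T i\<bar> * \<rho> ^ (fst (d i) + snd (d i))) summable_on I p"
      using T summable_on_subset_banach summable_on_def by blast
    then show ?thesis
      by (rule summable_on_cong[THEN iffD1, rotated]) (auto simp: I_def)
  qed
  have abs: "(\<lambda>i. \<bar>T i\<bar>) summable_on I p" for p
    using w[of p] \<open>0 < \<rho>\<close> by (simp add: summable_on_cmult_left')
  have c: "(T has_sum c p) (I p)" for p
    using abs_summable_summable[of T "I p"] abs[of p] unfolding c_def by (simp add: has_sum_infsum)
  \<comment> \<open>\<open>N p\<close> collects the weights of all monomials of degree
    \<open>p\<close>. It dominates the weighted \<open>c p\<close> by the triangle inequality and
    its total is still \<open>M'\<close>, so merging like monomials does not raise the
    bound.\<close>
  define N where "N p = (\<Sum>\<^sub>\<infinity>i\<in>I p. \<bar>T i\<bar>) * \<rho> ^ (fst p + snd p)" for p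
  have N: "(N has_sum M') UNIV"
  proof (rule has_sum_fibres[OF T])
    fix p
    have "((\<lambda>i. \<bar>T i\<bar> * \<rho> ^ (fst p + snd p)) has_sum N p) (I p)"
      unfolding N_def using abs by (intro has_sum_cmult_left has_sum_infsum)
    then show "((\<lambda>i. \<bar>T i\<bar> * \<rho> ^ (fst (d i) + snd (d i))) has_sum N p) {i. d i = p}"
      by (subst has_sum_cong[where g = "\<lambda>i. \<bar>T i\<bar> * \<rho> ^ (fst p + snd p)"]) (auto simp: I_def)
  qed
  have cN: "\<bar>c p\<bar> * \<rho> ^ (fst p + snd p) \<le> N p" for p
    unfolding N_def c_def using norm_infsum_bound[of T "I p"] abs[of p] \<open>0 < \<rho>\<close>
    by (intro mult_right_mono) auto
  have "(\<lambda>p. \<bar>c p\<bar> * \<rho> ^ (fst p + snd p)) summable_on UNIV"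
    by (rule summable_on_comparison_test[where f = N])
       (use N cN \<open>0 < \<rho>\<close> in \<open>auto simp: summable_on_def\<close>)
  then obtain M'' where M'': "((\<lambda>p. \<bar>c p\<bar> * \<rho> ^ (fst p + snd p)) has_sum M'') UNIV"
    by (auto simp: summable_on_def)
  have "M'' \<le> M'"
    using M'' N cN by (rule has_sum_mono)
  moreover have "((\<lambda>p. c p * s ^ fst p * t ^ snd p) has_sum f s t) UNIV"
    if "\<bar>s\<bar> \<le> \<rho>" "\<bar>t\<bar> \<le> \<rho>" for s t
  proof (rule has_sum_fibres[OF f[OF that]])
    fix p
    have "((\<lambda>i. T i * (s ^ fst p * t ^ snd p)) has_sum c p * (s ^ fst p * t ^ snd p)) (I p)"
      by (intro has_sum_cmult_left c)
    then show "((\<lambda>i. T i * s ^ fst (d i) * t ^ snd (d i)) has_sum c p * s ^ fst p * t ^ snd p)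
        {i. d i = p}"
      by (subst has_sum_cong[where g = "\<lambda>i. T i * (s ^ fst p * t ^ snd p)"])
         (auto simp: I_def mult.assoc)
  qed
  ultimately show ?thesis
    unfolding power_series_bound_def using M'' \<open>M' \<le> M\<close>
    by (intro exI[of _ c] exI[of _ M'']) auto
qed

section \<open>Constants, sums, products and compositions of majorised series\<close>

lemma power_series_bound_const:
  assumes "0 < \<rho>"
  shows "power_series_bound \<rho> (\<lambda>_ _. c) \<bar>c\<bar>"
proof -
  have unit: "((\<lambda>_::unit. r) has_sum r) UNIV" for r :: real
    using has_sum_finite[of "UNIV :: unit set" "\<lambda>_. r"] by simp
  show ?thesis
    by (rule power_series_boundI[where T = "\<lambda>_::unit. c" and d = "\<lambda>_. (0, 0)" and M' = "\<bar>c\<bar>"])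
       (use assms unit in simp_all)
qed

text \<open>The coefficients of all \<open>f k\<close> form a single family indexed by
  \<open>k\<close> and a pair of exponents. Its weights have a finite sum, so it may be summed over
  \<open>k\<close> last, which gives \<open>F\<close>, or grouped by degree, which gives a power
  series.\<close>

lemma power_series_bound_sum:
  fixes f :: "nat \<Rightarrow> real \<Rightarrow> real \<Rightarrow> real"
  assumes "0 < \<rho>" and f: "\<And>k. power_series_bound \<rho> (f k) (M k)"
    and M: "M summable_on UNIV"
    and F: "\<And>s t. \<bar>s\<bar> \<le> \<rho> \<Longrightarrow> \<bar>t\<bar> \<le> \<rho> \<Longrightarrow> (\<lambda>k. f k s t) sums F s t"
  shows "power_series_bound \<rho> F (infsum M UNIV)"
proof -
  \<comment> \<open>Bundling the three facts into one predicate lets coefficients and bound be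
    chosen together for every \<open>k\<close>.\<close>
  define P where "P k c M' \<longleftrightarrow> M' \<le> M k \<and>
        ((\<lambda>p. \<bar>c p\<bar> * \<rho> ^ (fst p + snd p)) has_sum M') UNIV \<and>
        (\<forall>s t. \<bar>s\<bar> \<le> \<rho> \<longrightarrow> \<bar>t\<bar> \<le> \<rho> \<longrightarrow>
           ((\<lambda>p. c p * s ^ fst p * t ^ snd p) has_sum f k s t) UNIV)" for k c M'
  have "\<exists>c M'. P k c M'" for k
    using f[of k] unfolding P_def power_series_bound_def by blast
  then obtain c M' where P: "\<And>k. P k (c k) (M' k)"
    by metis
  have M'M: "M' k \<le> M k"
    and M': "((\<lambda>p. \<bar>c k p\<bar> * \<rho> ^ (fst p + snd p)) has_sum M' k) UNIV" for k
    using P[of k] by (auto simp: P_def)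
  have c: "((\<lambda>p. c k p * s ^ fst p * t ^ snd p) has_sum f k s t) UNIV"
    if "\<bar>s\<bar> \<le> \<rho>" "\<bar>t\<bar> \<le> \<rho>" for k s t
    using P[of k] that by (auto simp: P_def)
  have M'0: "0 \<le> M' k" for k
    using M' by (rule has_sum_nonneg) (use \<open>0 < \<rho>\<close> in auto)
  have M'sum: "M' summable_on UNIV"
    by (rule summable_on_comparison_test[OF M]) (auto simp: M'M M'0)
  let ?W = "\<lambda>z :: nat \<times> nat \<times> nat. \<bar>c (fst z) (snd z)\<bar> * \<rho> ^ (fst (snd z) + snd (snd z))"
  have W: "(?W has_sum infsum M' UNIV) UNIV"
  proof -
    have "(?W has_sum infsum M' UNIV) (SIGMA k:UNIV. UNIV)"
    proof (rule has_sum_SigmaI)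
      show "((\<lambda>p. ?W (k, p)) has_sum M' k) UNIV" for k using M'[of k] by simp
      show "(M' has_sum infsum M' UNIV) UNIV" using M'sum by simp
      show "?W summable_on (SIGMA k:UNIV. UNIV)"
        using M' M'sum
        by (intro summable_on_SigmaI[where g = M']) (use \<open>0 < \<rho>\<close> in auto)
    qed
    then show ?thesis by simp
  qed
  show ?thesis
  proof (rule power_series_boundI[OF \<open>0 < \<rho>\<close> W])
    show "infsum M' UNIV \<le> infsum M UNIV"
      using M'sum M M'M by (rule infsum_mono)
    fix s t assume st: "\<bar>s\<bar> \<le> \<rho>" "\<bar>t\<bar> \<le> \<rho>"
    let ?G = "\<lambda>z :: nat \<times> nat \<times> nat. c (fst z) (snd z) * s ^ fst (snd z) * t ^ snd (snd z)"
    have "?G summable_on UNIV"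
      using W by (rule summable_on_majorant) (use st abs_monomial_le in simp)
    then obtain S where S: "(?G has_sum S) UNIV"
      by (auto simp: summable_on_def)
    have "((\<lambda>k. f k s t) has_sum S) UNIV"
      by (rule has_sum_SigmaD[where f = ?G and B = "\<lambda>_. UNIV"]) (use S c[OF st] in auto)
    then have "S = F s t"
      using F[OF st] has_sum_imp_sums sums_unique2 by blast
    then show "(?G has_sum F s t) UNIV" using S by simp
  qed
qed

text \<open>The product is a family indexed by pairs of monomials, whose weights multiply, so the
  double sum of weights factors. Collecting equal degrees is left to
  \<open>power_series_boundI\<close>.\<close>

lemma power_series_bound_mult:
  assumes "0 < \<rho>" "power_series_bound \<rho> f M" "power_series_bound \<rho> g N" 
  shows "power_series_bound \<rho> (\<lambda>s t. f s t * g s t) (M * N)"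
proof -
  obtain c M' where M': "M' \<le> M" "((\<lambda>p. \<bar>c p\<bar> * \<rho> ^ (fst p + snd p)) has_sum M') UNIV"
    and c: "\<forall>s t. \<bar>s\<bar> \<le> \<rho> \<longrightarrow> \<bar>t\<bar> \<le> \<rho> \<longrightarrow>
              ((\<lambda>p. c p * s ^ fst p * t ^ snd p) has_sum f s t) UNIV"
    using assms(2) unfolding power_series_bound_def by blast
  obtain e N' where N': "N' \<le> N" "((\<lambda>p. \<bar>e p\<bar> * \<rho> ^ (fst p + snd p)) has_sum N') UNIV"
    and e: "\<forall>s t. \<bar>s\<bar> \<le> \<rho> \<longrightarrow> \<bar>t\<bar> \<le> \<rho> \<longrightarrow>
              ((\<lambda>p. e p * s ^ fst p * t ^ snd p) has_sum g s t) UNIV"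
    using assms(3) unfolding power_series_bound_def by blast
  have nn: "0 \<le> M'" "0 \<le> N'"
    using has_sum_nonneg[OF M'(2)] has_sum_nonneg[OF N'(2)] \<open>0 < \<rho>\<close> by auto
  let ?W = "\<lambda>z :: (nat \<times> nat) \<times> (nat \<times> nat).
    (\<bar>c (fst z)\<bar> * \<rho> ^ (fst (fst z) + snd (fst z))) * (\<bar>e (snd z)\<bar> * \<rho> ^ (fst (snd z) + snd (snd z)))"
  have W: "(?W has_sum (M' * N')) UNIV"
  proof -
    have "(?W has_sum (M' * N')) (SIGMA k:UNIV. UNIV)"
    proof (rule has_sum_SigmaI)
      show i: "((\<lambda>q. ?W (p, q)) has_sum (\<bar>c p\<bar> * \<rho> ^ (fst p + snd p)) * N') UNIV" for p
        using has_sum_cmult_right[OF N'(2)] by simp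
      show o: "((\<lambda>p. (\<bar>c p\<bar> * \<rho> ^ (fst p + snd p)) * N') has_sum M' * N') UNIV"
        using has_sum_cmult_left[OF M'(2)] by simp
      show "?W summable_on (SIGMA k:UNIV. UNIV)"
        using i o by (intro summable_on_SigmaI) (use \<open>0 < \<rho>\<close> in \<open>auto simp: summable_on_def\<close>)
    qed
    then show ?thesis by simp
  qed
  let ?d = "\<lambda>z :: (nat \<times> nat) \<times> (nat \<times> nat). (fst (fst z) + fst (snd z), snd (fst z) + snd (snd z))"
  show ?thesis
  proof (rule power_series_boundI[where T = "\<lambda>z. c (fst z) * e (snd z)" and d = ?d])
    show W': "((\<lambda>z. \<bar>c (fst z) * e (snd z)\<bar> * \<rho> ^ (fst (?d z) + snd (?d z))) has_sum M' * N') UNIV"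
      using W by (simp add: abs_mult power_add algebra_simps)
    show "M' * N' \<le> M * N" using M' N' nn by (intro mult_mono) auto
    fix s t assume st: "\<bar>s\<bar> \<le> \<rho>" "\<bar>t\<bar> \<le> \<rho>"
    let ?G = "\<lambda>z. c (fst z) * e (snd z) * s ^ fst (?d z) * t ^ snd (?d z)"
    have "?G summable_on UNIV"
      using W' by (rule summable_on_majorant) (use st in \<open>intro abs_monomial_le\<close>)
    then obtain S where S: "(?G has_sum S) UNIV"
      by (auto simp: summable_on_def)
    have "((\<lambda>p. (c p * s ^ fst p * t ^ snd p) * g s t) has_sum S) UNIV"
    proof (rule has_sum_SigmaD[where f = ?G and B = "\<lambda>_. UNIV"])
      show "((\<lambda>q. ?G (p, q)) has_sum (c p * s ^ fst p * t ^ snd p) * g s t) UNIV" for p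
        using has_sum_cmult_right[OF e[rule_format, OF st], of "c p * s ^ fst p * t ^ snd p"]
        by (simp add: power_add mult_ac)
    qed (use S in auto)
    moreover have "((\<lambda>p. (c p * s ^ fst p * t ^ snd p) * g s t) has_sum f s t * g s t) UNIV"
      by (intro has_sum_cmult_left c[rule_format] st)
    ultimately show "(?G has_sum f s t * g s t) UNIV"
      using S has_sum_unique by blast
  qed fact
qed

lemma power_series_bound_power:
  assumes "0 < \<rho>" "power_series_bound \<rho> f M"
  shows "power_series_bound \<rho> (\<lambda>s t. f s t ^ n) (M ^ n)"
proof (induction n)
  case 0
  show ?case using power_series_bound_const[OF assms(1), of 1] by simp
next
  case (Suc n)
  show ?case using power_series_bound_mult[OF assms Suc] by simp
qed

text \<open>Submultiplicativity gives the \<open>n\<close>-th term the bound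
  \<open>\<bar>c n\<bar> * M ^ n\<close>, so absolute convergence of the outer series at the single
  number \<open>M\<close> suffices.\<close>

lemma power_series_bound_compose:
  fixes c :: "nat \<Rightarrow> real"
  assumes "0 < \<rho>" "power_series_bound \<rho> f M"
    and "summable (\<lambda>n. \<bar>c n\<bar> * M ^ n)" "0 \<le> M"
    and "\<And>s t. \<bar>s\<bar> \<le> \<rho> \<Longrightarrow> \<bar>t\<bar> \<le> \<rho> \<Longrightarrow> (\<lambda>n. c n * f s t ^ n) sums F s t"
  shows "\<exists>N. power_series_bound \<rho> F N"
proof -
  have "power_series_bound \<rho> F (infsum (\<lambda>n. \<bar>c n\<bar> * M ^ n) UNIV)"
  proof (rule power_series_bound_sum[OF \<open>0 < \<rho>\<close>])
    show "power_series_bound \<rho> (\<lambda>s t. c k * f s t ^ k) (\<bar>c k\<bar> * M ^ k)" for k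
      by (intro power_series_bound_mult power_series_bound_const power_series_bound_power assms)
    show "(\<lambda>n. \<bar>c n\<bar> * M ^ n) summable_on UNIV"
      using assms(3,4) by (intro norm_summable_imp_summable_on) (simp add: abs_mult)
  qed (use assms(5) in auto)
  then show ?thesis by blast
qed

lemma power_series_bound_fst:
  fixes c :: "nat \<Rightarrow> real"
  assumes "0 < \<rho>" "summable (\<lambda>n. \<bar>c n\<bar> * \<rho> ^ n)"
    and "\<And>s. \<bar>s\<bar> \<le> \<rho> \<Longrightarrow> (\<lambda>n. c n * s ^ n) sums f s"
  shows "power_series_bound \<rho> (\<lambda>s _. f s) (\<Sum>n. \<bar>c n\<bar> * \<rho> ^ n)"
proof (rule power_series_boundI[where T = c and d = "\<lambda>n. (n, 0)"])
  show "((\<lambda>n. \<bar>c n\<bar> * \<rho> ^ (fst (n, 0::nat) + snd (n, 0::nat))) has_sum (\<Sum>n. \<bar>c n\<bar> * \<rho> ^ n)) UNIV"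
    using assms(1,2) by (intro norm_summable_imp_has_sum) (auto simp: abs_mult power_abs summable_sums)
  fix s t :: real assume s: "\<bar>s\<bar> \<le> \<rho>"
  have "summable (\<lambda>n. norm (c n * s ^ n))"
    by (rule summable_comparison_test'[OF assms(2)])
       (use s in \<open>auto simp: abs_mult power_abs intro!: mult_left_mono power_mono\<close>)
  then show "((\<lambda>n. c n * s ^ fst (n, 0::nat) * t ^ snd (n, 0::nat)) has_sum f s) UNIV"
    using assms(3)[OF s] by (intro norm_summable_imp_has_sum) auto
qed (use assms in auto)

text \<open>One-variable series are set up in the first variable; this moves sech to the
  second.\<close>

lemma power_series_bound_swap:
  assumes "0 < \<rho>" "power_series_bound \<rho> f M"
  shows "power_series_bound \<rho> (\<lambda>s t. f t s) M"
proof -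
  obtain c M' where M': "M' \<le> M" "((\<lambda>p. \<bar>c p\<bar> * \<rho> ^ (fst p + snd p)) has_sum M') UNIV"
    and c: "\<forall>s t. \<bar>s\<bar> \<le> \<rho> \<longrightarrow> \<bar>t\<bar> \<le> \<rho> \<longrightarrow>
              ((\<lambda>p. c p * s ^ fst p * t ^ snd p) has_sum f s t) UNIV"
    using assms(2) unfolding power_series_bound_def by blast
  have "((\<lambda>p. c p * s ^ snd p * t ^ fst p) has_sum f t s) UNIV"
    if "\<bar>s\<bar> \<le> \<rho>" "\<bar>t\<bar> \<le> \<rho>" for s t
    using c[rule_format, OF that(2,1)] by (simp add: mult_ac)
  then show ?thesis
    by (intro power_series_boundI[where T = c and d = "\<lambda>p. (snd p, fst p)" and M' = M'])
       (use assms M' in \<open>simp_all add: add_ac\<close>)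
qed

section \<open>Bounds on values, and real analyticity\<close>

lemma power_series_bound_mono:
  "power_series_bound \<rho> f M \<Longrightarrow> M \<le> N \<Longrightarrow> power_series_bound \<rho> f N"
  unfolding power_series_bound_def by (meson order_trans)

text \<open>On the square each monomial is at most its weight. The estimate keeps the inner function
  inside the disc where the outer series converges.\<close>

lemma power_series_bound_abs_le:
  assumes "power_series_bound \<rho> f M" "\<bar>s\<bar> \<le> \<rho>" "\<bar>t\<bar> \<le> \<rho>"
  shows "\<bar>f s t\<bar> \<le> M"
proof -
  obtain c M' where M': "M' \<le> M" "((\<lambda>p. \<bar>c p\<bar> * \<rho> ^ (fst p + snd p)) has_sum M') UNIV"
    and c: "((\<lambda>p. c p * s ^ fst p * t ^ snd p) has_sum f s t) UNIV"
    using assms unfolding power_series_bound_def by blast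
  have "norm (f s t) \<le> M'"
    by (rule norm_infsum_le[OF c M'(2)]) (use assms(2,3) abs_monomial_le in simp)
  with M'(1) show ?thesis by simp
qed

lemma real_analytic_atI:
  assumes "0 < \<rho>" "power_series_bound \<rho> f M"
    and "\<And>s t. \<bar>s\<bar> \<le> \<rho> \<Longrightarrow> \<bar>t\<bar> \<le> \<rho> \<Longrightarrow> u (x + s, y + t) = f s t"
  shows "real_analytic_at u (x, y)"
proof -
  obtain c where c: "\<forall>s t. \<bar>s\<bar> \<le> \<rho> \<longrightarrow> \<bar>t\<bar> \<le> \<rho> \<longrightarrow>
              ((\<lambda>p. c p * s ^ fst p * t ^ snd p) has_sum f s t) UNIV"
    using assms(2) unfolding power_series_bound_def by blast
  have "((\<lambda>(m, n). c (m, n) * (fst q - x) ^ m * (snd q - y) ^ n) has_sum u q) UNIV"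
    if "q \<in> ball (x, y) \<rho>" for q
  proof -
    \<comment> \<open>A Euclidean ball lies in the square of half-side \<rho> about its centre,
      where the double series is available.\<close>
    have "dist x (fst q) \<le> \<rho>" "dist y (snd q) \<le> \<rho>"
      using that dist_fst_le[of "(x, y)" q] dist_snd_le[of "(x, y)" q] by auto
    then have "\<bar>fst q - x\<bar> \<le> \<rho>" "\<bar>snd q - y\<bar> \<le> \<rho>"
      by (auto simp: dist_real_def)
    with c[rule_format, OF this] assms(3)[OF this] show ?thesis by (simp add: case_prod_unfold)
  qed
  then show ?thesis
    unfolding real_analytic_at_def using \<open>0 < \<rho>\<close>
    by (intro exI[of _ "\<lambda>m n. c (m, n)"] exI[of _ \<rho>]) auto
qed

subsection \<open>Power series of cos, sech and the elliptic integral\<close>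

text \<open>The complex Taylor series converges on the whole disc of holomorphy; at real arguments
  its real part is the series of the real parts of the coefficients.\<close>

lemma holomorphic_imp_real_power_series:
  fixes f :: "real \<Rightarrow> real"
  assumes "G holomorphic_on ball (of_real x) r"
    and "\<And>s. \<bar>s\<bar> < r \<Longrightarrow> f (x + s) = Re (G (of_real (x + s)))"
  shows "\<exists>c. \<forall>s. \<bar>s\<bar> < r \<longrightarrow> (\<lambda>n. c n * s ^ n) sums f (x + s)"
proof (intro exI allI impI)
  define b where "b n = (deriv ^^ n) G (of_real x) / fact n" for n
  fix s :: real assume s: "\<bar>s\<bar> < r"
  have "of_real (x + s) \<in> ball (of_real x :: complex) r"
    using s by (simp add: dist_norm)
  from holomorphic_power_series[OF assms(1) this]
  have "(\<lambda>n. Re (b n * of_real s ^ n)) sums Re (G (of_real (x + s)))"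
    unfolding b_def by (intro sums_Re) simp
  then show "(\<lambda>n. Re (b n) * s ^ n) sums f (x + s)"
    using assms(2)[OF s] by (simp flip: of_real_power)
qed

lemma abs_summable_power_series:
  fixes c :: "nat \<Rightarrow> real"
  assumes "\<And>s. \<bar>s\<bar> < r \<Longrightarrow> summable (\<lambda>n. c n * s ^ n)" "0 \<le> \<rho>" "\<rho> < r"
  shows "summable (\<lambda>n. \<bar>c n\<bar> * \<rho> ^ n)"
proof -
  obtain K where "\<rho> < K" "K < r" using dense[OF assms(3)] by blast
  then show ?thesis
    using powser_insidea[of c K \<rho>] assms(1)[of K] assms(2) by (simp add: abs_mult)
qed

text \<open>The weighted norm of the coefficients is continuous in \<rho> and equals
  \<open>\<bar>f 0\<bar>\<close> at \<rho> = 0, so a small square brings it as close to the central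
  value as desired.\<close>

lemma power_series_bound_small:
  fixes c :: "nat \<Rightarrow> real"
  assumes c: "\<And>s. \<bar>s\<bar> < r \<Longrightarrow> (\<lambda>n. c n * s ^ n) sums f s"
    and "0 < r" "\<bar>f 0\<bar> < B"
  shows "\<exists>\<delta>>0. \<forall>\<rho>. 0 < \<rho> \<and> \<rho> < \<delta> \<longrightarrow> power_series_bound \<rho> (\<lambda>s _. f s) B"
proof -
  let ?g = "\<lambda>x. \<Sum>n. \<bar>c n\<bar> * x ^ n"
  have sm: "summable (\<lambda>n. \<bar>c n\<bar> * \<rho> ^ n)" if "0 \<le> \<rho>" "\<rho> < r" for \<rho>
    using c that by (intro abs_summable_power_series[of r]) (auto simp: sums_iff)
  have "c 0 = f 0"
    using c[of 0] \<open>0 < r\<close> by (simp add: sums_iff powser_zero)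
  then have "?g 0 < B"
    using assms(3) by (simp add: powser_zero)
  moreover have "isCont ?g 0"
    using sm[of "r / 2"] \<open>0 < r\<close> by (intro isCont_powser[of _ "r / 2"]) auto
  ultimately have "\<forall>\<^sub>F x in at 0. ?g x < B"
    by (simp add: isCont_def order_tendstoD(2))
  then obtain \<delta> where \<delta>: "0 < \<delta>" "\<And>x. x \<noteq> 0 \<Longrightarrow> \<bar>x\<bar> < \<delta> \<Longrightarrow> ?g x < B"
    by (auto simp: eventually_at dist_real_def)
  show ?thesis
  proof (intro exI[of _ "min \<delta> r"] conjI allI impI)
    show "0 < min \<delta> r" using \<delta> \<open>0 < r\<close> by simp
    fix \<rho> assume \<rho>: "0 < \<rho> \<and> \<rho> < min \<delta> r"
    then have "power_series_bound \<rho> (\<lambda>s _. f s) (?g \<rho>)"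
      using sm c by (intro power_series_bound_fst) auto
    then show "power_series_bound \<rho> (\<lambda>s _. f s) B"
      by (rule power_series_bound_mono) (use \<delta>(2)[of \<rho>] \<rho> in auto)
  qed
qed

section \<open>The factors cos and sech near an arbitrary point\<close>

lemma cos_power_series_bound:
  fixes a x B :: real
  assumes "\<bar>cos (a * x)\<bar> < B"
  shows "\<exists>\<delta>>0. \<forall>\<rho>. 0 < \<rho> \<and> \<rho> < \<delta> \<longrightarrow> power_series_bound \<rho> (\<lambda>s _. cos (a * (x + s))) B"
proof -
  have "\<exists>c. \<forall>s. \<bar>s\<bar> < 1 \<longrightarrow> (\<lambda>n. c n * s ^ n) sums cos (a * (x + s))"
    by (rule holomorphic_imp_real_power_series[where G = "\<lambda>z. cos (of_real a * z)"])
       (auto intro!: holomorphic_intros simp: cos_of_real simp flip: of_real_add of_real_mult)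
  then obtain c where "\<And>s. \<bar>s\<bar> < 1 \<Longrightarrow> (\<lambda>n. c n * s ^ n) sums cos (a * (x + s))"
    by blast
  then show ?thesis
    by (rule power_series_bound_small) (use assms in auto)
qed

lemma sech_power_series_bound:
  fixes a y B :: real
  assumes "1 / cosh (a * y) < B"
  shows "\<exists>\<delta>>0. \<forall>\<rho>. 0 < \<rho> \<and> \<rho> < \<delta> \<longrightarrow> power_series_bound \<rho> (\<lambda>s _. 1 / cosh (a * (y + s))) B"
proof -
  \<comment> \<open>\<open>?D z\<close> is twice cosh of \<open>a * z\<close>. It has no zero on the
    real axis, so by continuity sech is holomorphic on some disc about \<open>y\<close>.\<close>
  let ?D = "\<lambda>z. exp (of_real a * z) + exp (- (of_real a * z)) :: complex"
  have real: "?D (of_real s) = of_real (2 * cosh (a * s))" for s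
  proof -
    have "2 * cosh (a * s) = exp (a * s) + exp (- (a * s))"
      by (simp add: cosh_def)
    moreover have "?D (of_real s) = of_real (exp (a * s)) + of_real (exp (- (a * s)))"
      by (simp only: exp_of_real[symmetric] of_real_mult of_real_minus)
    ultimately show ?thesis by (simp only: of_real_add)
  qed
  have "open {z. ?D z \<noteq> 0}"
    by (intro open_Collect_neq continuous_intros)
  moreover have "of_real y \<in> {z. ?D z \<noteq> 0}"
    by (simp add: real del: of_real_mult)
  ultimately obtain r where r: "0 < r" "ball (of_real y) r \<subseteq> {z. ?D z \<noteq> 0}"
    by (meson open_contains_ball)
  have "\<exists>c. \<forall>s. \<bar>s\<bar> < r \<longrightarrow> (\<lambda>n. c n * s ^ n) sums (1 / cosh (a * (y + s)))"
  proof (rule holomorphic_imp_real_power_series[where G = "\<lambda>z. 2 / ?D z"])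
    show "(\<lambda>z. 2 / ?D z) holomorphic_on ball (of_real y) r"
      using r by (intro holomorphic_intros) auto
    show "1 / cosh (a * (y + s)) = Re (2 / ?D (of_real (y + s)))" for s
      unfolding real by (simp add: Re_divide_of_real)
  qed
  then obtain c where "\<And>s. \<bar>s\<bar> < r \<Longrightarrow> (\<lambda>n. c n * s ^ n) sums (1 / cosh (a * (y + s)))"
    by blast
  then show ?thesis
    by (rule power_series_bound_small) (use assms r in auto)
qed

section \<open>The elliptic integral as an analytic function on (-1, 1)\<close>

context
  fixes k :: real
  assumes k: "0 \<le> k" "k < 1"
begin

lemma elliptic_radicand_pos:
  assumes "\<bar>w\<bar> < 1"
  shows "0 < 1 - w\<^sup>2" "0 < 1 - k\<^sup>2 * w\<^sup>2"
proof -
  have "\<bar>k * w\<bar> < 1"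
    using k assms mult_left_le[of "\<bar>w\<bar>" k] by (simp add: abs_mult)
  then show "0 < 1 - k\<^sup>2 * w\<^sup>2"
    by (simp add: abs_square_less_1 flip: power_mult_distrib)
  show "0 < 1 - w\<^sup>2" using assms by (simp add: abs_square_less_1)
qed

lemma DERIV_elliptic_F:
  assumes "\<bar>w\<bar> < 1"
  shows "((\<lambda>w. elliptic_F w k) has_real_derivative 1 / sqrt ((1 - w\<^sup>2) * (1 - k\<^sup>2 * w\<^sup>2))) (at w)"
proof -
  \<comment> \<open>Stopping at \<open>b < 1\<close> keeps the integrand continuous, away from its
    singularities at 1 and -1.\<close>
  obtain b where b: "\<bar>w\<bar> < b" "b < 1" using dense[OF assms] by blast
  have "((\<lambda>u. LBINT s=ereal 0..ereal u. 1 / sqrt ((1 - s\<^sup>2) * (1 - k\<^sup>2 * s\<^sup>2)))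
      has_vector_derivative 1 / sqrt ((1 - w\<^sup>2) * (1 - k\<^sup>2 * w\<^sup>2))) (at w within {-b..b})"
  proof (rule interval_integral_FTC2)
    show "continuous_on {-b..b} (\<lambda>s. 1 / sqrt ((1 - s\<^sup>2) * (1 - k\<^sup>2 * s\<^sup>2)))"
    proof (intro continuous_intros ballI)
      fix s assume "s \<in> {-b..b}"
      then have "\<bar>s\<bar> < 1" using b by auto
      from elliptic_radicand_pos[OF this]
      show "sqrt ((1 - s\<^sup>2) * (1 - k\<^sup>2 * s\<^sup>2)) \<noteq> 0" by simp
    qed
  qed (use b in auto)
  moreover have "at w within {-b..b} = at w"
    using b by (intro at_within_Icc_at) auto
  ultimately show ?thesis
    by (simp add: elliptic_F_def has_real_derivative_iff_has_vector_derivative zero_ereal_def)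
qed

text \<open>The integrand extends holomorphically to the unit disc, which is convex, so it has a
  primitive there. On (-1, 1) the real part of that primitive differs from the elliptic integral by
  a constant, since the derivatives agree.\<close>

lemma elliptic_F_power_series:
  "\<exists>c. \<forall>w. \<bar>w\<bar> < 1 \<longrightarrow> (\<lambda>n. c n * w ^ n) sums elliptic_F w k"
proof -
  \<comment> \<open>Both radicands have positive real part on the unit disc, so each principal root
    stays off its branch cut and does not vanish.\<close>
  let ?g = "\<lambda>z. 1 / (csqrt (1 - z\<^sup>2) * csqrt (1 - (of_real k)\<^sup>2 * z\<^sup>2))"
  have Re_pos: "0 < Re (1 - z\<^sup>2)" if "norm z < 1" for z :: complex
  proof -
    have "Re (z\<^sup>2) \<le> norm z ^ 2" using complex_Re_le_cmod[of "z\<^sup>2"] by (simp add: norm_power)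
    also have "\<dots> < 1" using that by (simp add: power_less_one_iff)
    finally show ?thesis by simp
  qed
  have Re_pos': "0 < Re (1 - (of_real k)\<^sup>2 * z\<^sup>2)" if "norm z < 1" for z :: complex
  proof -
    have "norm (of_real k * z) < 1"
      using k that mult_left_le[of "norm z" k] by (simp add: norm_mult)
    from Re_pos[OF this] show ?thesis by (simp add: power_mult_distrib)
  qed
  have nonpos: "z \<notin> \<real>\<^sub>\<le>\<^sub>0" if "0 < Re z" for z :: complex
    using that by (auto simp: complex_nonpos_Reals_iff)
  have "?g holomorphic_on ball 0 1"
  proof (intro holomorphic_intros)
    fix z :: complex assume "z \<in> ball 0 1"
    then have z: "norm z < 1" by simp
    show "1 - z\<^sup>2 \<notin> \<real>\<^sub>\<le>\<^sub>0" "1 - (of_real k)\<^sup>2 * z\<^sup>2 \<notin> \<real>\<^sub>\<le>\<^sub>0"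
      using Re_pos[OF z] Re_pos'[OF z] nonpos by blast+
    have "1 - z\<^sup>2 \<noteq> 0" "1 - (of_real k)\<^sup>2 * z\<^sup>2 \<noteq> 0"
      using Re_pos[OF z] Re_pos'[OF z] by (metis less_irrefl zero_complex.sel(1))+
    then show "csqrt (1 - z\<^sup>2) * csqrt (1 - (of_real k)\<^sup>2 * z\<^sup>2) \<noteq> 0"
      by simp
  qed
  then obtain G where G: "\<And>z. z \<in> ball 0 1 \<Longrightarrow> (G has_field_derivative ?g z) (at z within ball 0 1)"
    by (rule holomorphic_convex_primitive'[rotated 2]) auto
  have G': "(G has_field_derivative ?g z) (at z)" if "z \<in> ball 0 1" for z
    using G[OF that] at_within_open[OF that open_ball] by (simp only:)
  have real: "?g (of_real w) = of_real (1 / sqrt ((1 - w\<^sup>2) * (1 - k\<^sup>2 * w\<^sup>2)))"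
    if "\<bar>w\<bar> < 1" for w
  proof -
    have "csqrt (1 - (of_real w)\<^sup>2) = of_real (sqrt (1 - w\<^sup>2))"
      "csqrt (1 - (of_real k)\<^sup>2 * (of_real w)\<^sup>2) = of_real (sqrt (1 - k\<^sup>2 * w\<^sup>2))"
      using elliptic_radicand_pos[OF that] csqrt_of_real[of "1 - w\<^sup>2"]
        csqrt_of_real[of "1 - k\<^sup>2 * w\<^sup>2"] by simp_all
    then show ?thesis by (simp add: real_sqrt_mult)
  qed
  have const: "\<exists>d. \<forall>w\<in>{-1<..<1}. elliptic_F w k - Re (G (of_real w)) = d"
  proof (rule has_field_derivative_zero_constant)
    fix w :: real assume "w \<in> {-1<..<1}"
    then have w: "\<bar>w\<bar> < 1" by auto
    then have "(of_real w :: complex) \<in> ball 0 1" by simp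
    from G'[OF this]
    have "((\<lambda>w. G (of_real w)) has_vector_derivative ?g (of_real w)) (at w)"
      by (rule has_vector_derivative_real_field)
    then have "((\<lambda>w. Re (G (of_real w))) has_real_derivative
        1 / sqrt ((1 - w\<^sup>2) * (1 - k\<^sup>2 * w\<^sup>2))) (at w)"
      using has_field_derivative_Re unfolding real[OF w] by fastforce
    from DERIV_diff[OF DERIV_elliptic_F[OF w] this]
    show "((\<lambda>w. elliptic_F w k - Re (G (of_real w))) has_field_derivative 0)
        (at w within {-1<..<1})"
      by (simp add: has_field_derivative_at_within)
  qed simp
  then obtain d where d: "\<And>w. \<bar>w\<bar> < 1 \<Longrightarrow> elliptic_F w k = Re (G (of_real w) + of_real d)"
    by (force simp: algebra_simps)
  have "(\<lambda>z. G z + of_real d) holomorphic_on ball 0 1"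
    using G by (intro holomorphic_intros holomorphic_onI) (auto simp: field_differentiable_def)
  then have "\<exists>c. \<forall>w. \<bar>w\<bar> < 1 \<longrightarrow> (\<lambda>n. c n * w ^ n) sums elliptic_F (0 + w) k"
    by (intro holomorphic_imp_real_power_series[where G = "\<lambda>z. G z + of_real d"]) (use d in auto)
  then show ?thesis by simp
qed

section \<open>Analyticity of the composite off the singular set\<close>

lemma exists_perturbed_product_less_1:
  fixes c h :: real
  assumes "0 \<le> c" "c \<le> 1" "0 \<le> h" "h \<le> 1" "c * h < 1"
  shows "\<exists>\<epsilon>>0. (c + \<epsilon>) * (h + \<epsilon>) < 1"
proof -
  \<comment> \<open>The gap \<open>1 - c * h\<close> is cut into four parts; the two cross terms and
    the square use at most three of them.\<close>
  define \<epsilon> where "\<epsilon> = (1 - c * h) / 4"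
  have "0 \<le> c * h" using assms by simp
  then have \<epsilon>: "0 < \<epsilon>" "\<epsilon> \<le> 1" using assms(5) by (auto simp: \<epsilon>_def)
  have "c * \<epsilon> \<le> \<epsilon>" "h * \<epsilon> \<le> \<epsilon>" "\<epsilon> * \<epsilon> \<le> \<epsilon>"
    using assms \<epsilon> by (simp_all add: mult_left_le_one_le)
  then have "(c + \<epsilon>) * (h + \<epsilon>) \<le> c * h + 3 * \<epsilon>" by (simp add: algebra_simps)
  also have "\<dots> < 1" using assms(5) by (simp add: \<epsilon>_def field_simps)
  finally show ?thesis using \<epsilon> by blast
qed

lemma real_analytic_at_scaled_elliptic_F:
  fixes a x y :: real
  assumes "\<bar>cos (a * x)\<bar> < cosh (a * y)"
  shows "real_analytic_at (\<lambda>(x, y). b * elliptic_F (cos (a * x) / cosh (a * y)) k) (x, y)"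
proof -
  let ?c = "\<bar>cos (a * x)\<bar>" and ?h = "1 / cosh (a * y)"
  have ch: "0 \<le> ?c" "?c \<le> 1" "0 < ?h" "?h \<le> 1" "?c * ?h < 1"
    using assms cosh_real_ge_1[of "a * y"] by (auto simp: field_simps)
  \<comment> \<open>\<open>?c * ?h\<close> is the absolute value of w at the centre. The slack
    \<epsilon> lets both coefficient norms exceed their central values while the product
    \<open>M\<close> stays below 1, where the series of the elliptic integral still converges
    absolutely.\<close>
  obtain \<epsilon> where \<epsilon>: "0 < \<epsilon>" and "(?c + \<epsilon>) * (?h + \<epsilon>) < 1"
    using ch exists_perturbed_product_less_1[of ?c ?h] by auto
  define M where "M = (?c + \<epsilon>) * (?h + \<epsilon>)"
  have "M < 1" by (simp only: M_def) fact
  have "0 \<le> M" using ch \<epsilon> unfolding M_def by (intro mult_nonneg_nonneg) auto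
  obtain \<delta>1 where \<delta>1: "0 < \<delta>1" "\<And>\<rho>. 0 < \<rho> \<Longrightarrow> \<rho> < \<delta>1 \<Longrightarrow>
      power_series_bound \<rho> (\<lambda>s _. cos (a * (x + s))) (?c + \<epsilon>)"
    using cos_power_series_bound[of a x "?c + \<epsilon>"] \<epsilon> by auto
  obtain \<delta>2 where \<delta>2: "0 < \<delta>2" "\<And>\<rho>. 0 < \<rho> \<Longrightarrow> \<rho> < \<delta>2 \<Longrightarrow>
      power_series_bound \<rho> (\<lambda>s _. 1 / cosh (a * (y + s))) (?h + \<epsilon>)"
    using sech_power_series_bound[of a y "?h + \<epsilon>"] \<epsilon> by auto
  define \<rho> where "\<rho> = min \<delta>1 \<delta>2 / 2"
  have \<rho>: "0 < \<rho>" "\<rho> < \<delta>1" "\<rho> < \<delta>2"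
    using \<delta>1(1) \<delta>2(1) by (auto simp: \<rho>_def)
  let ?w = "\<lambda>s t. cos (a * (x + s)) * (1 / cosh (a * (y + t)))"
  have w: "power_series_bound \<rho> ?w M"
    unfolding M_def
    by (intro power_series_bound_mult power_series_bound_swap[of _ "\<lambda>s _. 1 / cosh (a * (y + s))"]
          \<delta>1 \<delta>2 \<rho>)
  obtain c where c: "\<And>w. \<bar>w\<bar> < 1 \<Longrightarrow> (\<lambda>n. c n * w ^ n) sums elliptic_F w k"
    using elliptic_F_power_series by blast
  have w1: "\<bar>?w s t\<bar> < 1" if "\<bar>s\<bar> \<le> \<rho>" "\<bar>t\<bar> \<le> \<rho>" for s t
    using power_series_bound_abs_le[OF w that] \<open>M < 1\<close> by linarith
  obtain N where N: "power_series_bound \<rho> (\<lambda>s t. elliptic_F (?w s t) k) N"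
  proof -
    have "summable (\<lambda>n. \<bar>c n\<bar> * M ^ n)"
      using c \<open>0 \<le> M\<close> \<open>M < 1\<close> by (intro abs_summable_power_series[of 1]) (auto simp: sums_iff)
    from power_series_bound_compose[OF \<rho>(1) w this \<open>0 \<le> M\<close>, of "\<lambda>s t. elliptic_F (?w s t) k"]
    show ?thesis using that c w1 by blast
  qed
  show ?thesis
    by (rule real_analytic_atI[OF \<rho>(1) power_series_bound_mult[OF \<rho>(1) power_series_bound_const[OF \<rho>(1), of b] N]])
       simp
qed

end

subsection \<open>The surface and its differential equation\<close>

text \<open>Clearing to the denominator \<open>sqrt (D x) ^ 3\<close> gives the three second
  partials a common denominator, so that only a polynomial numerator is left of the differential
  equation.\<close>

lemma DERIV_divide_sqrt:
  fixes f D :: "real \<Rightarrow> real"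
  assumes "(f has_real_derivative f') (at x)" "(D has_real_derivative D') (at x)" "0 < D x"
  shows "((\<lambda>s. f s / sqrt (D s)) has_real_derivative
           (f' * D x - f x * D' / 2) / sqrt (D x) ^ 3) (at x)"
proof -
  define R where "R = sqrt (D x)"
  have R: "0 < R" "D x = R * R" using assms(3) by (auto simp: R_def)
  have "((\<lambda>s. sqrt (D s)) has_real_derivative (inverse R / 2) * D') (at x)"
    unfolding R_def using assms by (intro DERIV_chain2[OF DERIV_real_sqrt])
  from DERIV_divide[OF assms(1) this]
  have "((\<lambda>s. f s / sqrt (D s)) has_real_derivative
           (f' * R - f x * (inverse R / 2 * D')) / (R * R)) (at x)"
    using R(1) unfolding R_def by simp
  moreover have "(f' * R - f x * (inverse R / 2 * D')) / (R * R) = (f' * D x - f x * D' / 2) / R ^ 3"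
    using R by (simp add: field_simps power3_eq_cube)
  ultimately show ?thesis by (simp only: R_def)
qed

text \<open>Here X, Y and m stand for cos^2 ax, cosh^2 ay and \<alpha>^2, hence \<open>1 - X\<close>
  for sin^2 and \<open>Y - 1\<close> for sinh^2. The three summands are those of the differential
  equation up to a common factor.\<close>

lemma maximal_surface_polynomial_identity:
  fixes X Y m :: real
  defines "A \<equiv> Y - X" and "B \<equiv> Y - m * X"
  shows "(A * B - (1 - m) * X * (Y - 1)) * (A * B - (1 - X) * (B + m * A))
    + 2 * (1 - m) * (1 - X) * (Y - 1) * (A * B - Y * (A + B))
    + (A * B - (1 - m) * (1 - X) * Y) * (A * B - (Y - 1) * (A + B)) = 0"
  unfolding A_def B_def by algebra

text \<open>Only for \<open>y = 0\<close> can cosh drop to 1, and then equality would force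
  \<open>sin (a * x) = 0\<close>, hence a point of the singular set. The complement of that set is
  used only through this strict inequality.\<close>

lemma abs_cos_less_cosh:
  assumes "0 < a" "(x, y) \<notin> singular_set a"
  shows "\<bar>cos (a * x)\<bar> < cosh (a * y)"
proof (cases "y = 0")
  case True
  have "\<bar>cos (a * x)\<bar> \<noteq> 1"
  proof
    assume "\<bar>cos (a * x)\<bar> = 1"
    then have "(cos (a * x))\<^sup>2 = 1" by (simp add: abs_square_eq_1)
    then have "sin (a * x) = 0" by (simp add: cos_squared_eq)
    then obtain i :: int where "a * x = of_int i * pi" by (auto simp: sin_zero_iff_int2)
    then have "x = pi * of_int i / a" using \<open>0 < a\<close> by (simp add: field_simps)
    with True assms(2) show False by (auto simp: singular_set_def)
  qed
  then show ?thesis using True by (simp add: less_le)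
next
  case False
  have "\<bar>cos (a * x)\<bar> \<le> 1" by simp
  also have "1 < cosh (a * y)"
    using False \<open>0 < a\<close> cosh_real_ge_1[of "a * y"] cosh_real_one_iff[of "a * y"]
    by (simp add: less_le)
  finally show ?thesis .
qed

section \<open>First and second partial derivatives of the graph\<close>

context
  fixes a \<alpha> \<alpha>' :: real
  assumes a: "0 < a" and \<alpha>: "0 < \<alpha>" "\<alpha> < 1" and \<alpha>': "\<alpha>' = sqrt (1 - \<alpha>\<^sup>2)"
begin

definition sn_graph :: "real \<times> real \<Rightarrow> real" where
  "sn_graph = (\<lambda>(x, y). \<alpha>' / a * elliptic_F (cos (a * x) / cosh (a * y)) \<alpha>)"

text \<open>\<open>rad1\<close> and \<open>rad2\<close> are A and B of the outline: cosh^2 ay times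
  1 - w^2 and 1 - \<alpha>^2 w^2, the two factors under the root of the elliptic integrand cleared
  of denominators.\<close>

definition rad1 :: "real \<Rightarrow> real \<Rightarrow> real" where
  "rad1 x y = (cosh (a * y))\<^sup>2 - (cos (a * x))\<^sup>2"

definition rad2 :: "real \<Rightarrow> real \<Rightarrow> real" where
  "rad2 x y = (cosh (a * y))\<^sup>2 - \<alpha>\<^sup>2 * (cos (a * x))\<^sup>2"

abbreviation rad :: "real \<Rightarrow> real \<Rightarrow> real" where
  "rad x y \<equiv> rad1 x y * rad2 x y"

lemma alpha'_square: "\<alpha>'\<^sup>2 = 1 - \<alpha>\<^sup>2"
  using \<alpha> by (simp add: \<alpha>' power_le_one)

lemma alpha'_pos: "0 < \<alpha>'"
  using \<alpha> by (simp add: \<alpha>' power_less_one_iff)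

lemma rad_pos:
  assumes "\<bar>cos (a * x)\<bar> < cosh (a * y)"
  shows "0 < rad1 x y" "0 < rad2 x y"
proof -
  have sq: "(cos (a * x))\<^sup>2 < (cosh (a * y))\<^sup>2"
    using power_strict_mono[OF assms, of 2] by simp
  then show "0 < rad1 x y" by (simp add: rad1_def)
  have "\<alpha>\<^sup>2 * (cos (a * x))\<^sup>2 \<le> (cos (a * x))\<^sup>2"
    using \<alpha> by (intro mult_left_le_one_le) (auto simp: power_le_one)
  with sq show "0 < rad2 x y" by (simp add: rad2_def)
qed

lemma DERIV_rad_x:
  "((\<lambda>s. rad s y) has_real_derivative
     2 * a * cos (a * x) * sin (a * x) * (rad2 x y + \<alpha>\<^sup>2 * rad1 x y)) (at x)"
  unfolding rad1_def rad2_def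
  by (auto intro!: derivative_eq_intros simp: algebra_simps power2_eq_square)

lemma DERIV_rad_y:
  "((\<lambda>t. rad x t) has_real_derivative
     2 * a * cosh (a * y) * sinh (a * y) * (rad2 x y + rad1 x y)) (at y)"
  unfolding rad1_def rad2_def
  by (auto intro!: derivative_eq_intros simp: algebra_simps power2_eq_square)

lemma DERIV_elliptic_F_quotient:
  assumes "\<bar>cos (a * x)\<bar> < cosh (a * y)"
  shows "((\<lambda>w. elliptic_F w \<alpha>) has_real_derivative (cosh (a * y))\<^sup>2 / sqrt (rad x y))
    (at (cos (a * x) / cosh (a * y)))"
proof -
  let ?w = "cos (a * x) / cosh (a * y)"
  have "\<bar>?w\<bar> < 1" using assms by (simp add: field_simps)
  note DERIV_elliptic_F[OF less_imp_le[OF \<alpha>(1)] \<alpha>(2) this]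
  moreover have "(1 - ?w\<^sup>2) * (1 - \<alpha>\<^sup>2 * ?w\<^sup>2) = rad x y / ((cosh (a * y))\<^sup>2)\<^sup>2"
    by (simp add: rad1_def rad2_def field_simps power2_eq_square)
  ultimately show ?thesis by (simp only: real_sqrt_divide real_sqrt_abs) simp
qed

lemma partial_x_sn_graph:
  assumes "\<bar>cos (a * x)\<bar> < cosh (a * y)"
  shows "partial_x sn_graph (x, y) = - (\<alpha>' * sin (a * x) * cosh (a * y)) / sqrt (rad x y)"
proof -
  have "((\<lambda>s. cos (a * s) / cosh (a * y)) has_real_derivative
      - (a * sin (a * x)) / cosh (a * y)) (at x)"
    by (auto intro!: derivative_eq_intros)
  from DERIV_cmult[OF DERIV_chain2[OF DERIV_elliptic_F_quotient[OF assms] this], of "\<alpha>' / a"]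
  have "((\<lambda>s. sn_graph (s, y)) has_real_derivative
      \<alpha>' / a * ((cosh (a * y))\<^sup>2 / sqrt (rad x y) * (- (a * sin (a * x)) / cosh (a * y)))) (at x)"
    by (simp add: sn_graph_def)
  then show ?thesis
    unfolding partial_x_def using a by (simp add: DERIV_imp_deriv power2_eq_square)
qed

lemma partial_y_sn_graph:
  assumes "\<bar>cos (a * x)\<bar> < cosh (a * y)"
  shows "partial_y sn_graph (x, y) = - (\<alpha>' * cos (a * x) * sinh (a * y)) / sqrt (rad x y)"
proof -
  have "((\<lambda>t. cos (a * x) / cosh (a * t)) has_real_derivative
      - (cos (a * x) * (a * sinh (a * y))) / (cosh (a * y))\<^sup>2) (at y)"
    by (auto intro!: derivative_eq_intros simp: power2_eq_square)
  from DERIV_cmult[OF DERIV_chain2[OF DERIV_elliptic_F_quotient[OF assms] this], of "\<alpha>' / a"]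
  have "((\<lambda>t. sn_graph (x, t)) has_real_derivative \<alpha>' / a *
      ((cosh (a * y))\<^sup>2 / sqrt (rad x y) * (- (cos (a * x) * (a * sinh (a * y))) / (cosh (a * y))\<^sup>2)))
      (at y)"
    by (simp add: sn_graph_def)
  then show ?thesis
    unfolding partial_y_def using a by (simp add: DERIV_imp_deriv)
qed

text \<open>The formulas for the first partials are available only under this inequality. It is an
  open condition, so they hold near the point along each axis, as differentiating them again
  requires.\<close>

lemma eventually_abs_cos_less_cosh:
  assumes "\<bar>cos (a * x)\<bar> < cosh (a * y)"
  shows "\<forall>\<^sub>F s in nhds x. \<bar>cos (a * s)\<bar> < cosh (a * y)"
    and "\<forall>\<^sub>F t in nhds y. \<bar>cos (a * x)\<bar> < cosh (a * t)"
proof -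
  have "open {s. \<bar>cos (a * s)\<bar> < cosh (a * y)}" "open {t. \<bar>cos (a * x)\<bar> < cosh (a * t)}"
    by (intro open_Collect_less continuous_intros)+
  with assms show "\<forall>\<^sub>F s in nhds x. \<bar>cos (a * s)\<bar> < cosh (a * y)"
    "\<forall>\<^sub>F t in nhds y. \<bar>cos (a * x)\<bar> < cosh (a * t)"
    by (auto simp: eventually_nhds)
qed

lemma second_partials_sn_graph:
  assumes "\<bar>cos (a * x)\<bar> < cosh (a * y)"
  defines "A \<equiv> rad1 x y" and "B \<equiv> rad2 x y"
    and "c \<equiv> cos (a * x)" and "s \<equiv> sin (a * x)" and "C \<equiv> cosh (a * y)" and "S \<equiv> sinh (a * y)"
  shows "partial_x (partial_x sn_graph) (x, y) =
      - (\<alpha>' * a * c * C) * (A * B - s\<^sup>2 * (B + \<alpha>\<^sup>2 * A)) / sqrt (A * B) ^ 3" (is "_ = ?xx")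
    and "partial_y (partial_x sn_graph) (x, y) =
      - (\<alpha>' * a * s * S) * (A * B - C\<^sup>2 * (B + A)) / sqrt (A * B) ^ 3" (is "_ = ?xy")
    and "partial_y (partial_y sn_graph) (x, y) =
      - (\<alpha>' * a * c * C) * (A * B - S\<^sup>2 * (B + A)) / sqrt (A * B) ^ 3" (is "_ = ?yy")
proof -
  note defs = A_def B_def c_def s_def C_def S_def
  have pos: "0 < rad x y" using rad_pos[OF assms(1)] by simp
  have "((\<lambda>s. - (\<alpha>' * sin (a * s) * cosh (a * y))) has_real_derivative
      - (\<alpha>' * (a * cos (a * x)) * cosh (a * y))) (at x)"
    by (auto intro!: derivative_eq_intros)
  note deriv = DERIV_divide_sqrt[OF this DERIV_rad_x pos]
  \<comment> \<open>Half the derivative of the radicand contributes \<open>a * c * s\<close>; its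
    \<open>s\<close> joins the one in the first partial to form \<open>s\<^sup>2\<close>, and
    \<open>\<alpha>' * a * c * C\<close> factors out.\<close>
  have "((\<lambda>s. - (\<alpha>' * sin (a * s) * cosh (a * y)) / sqrt (rad s y)) has_real_derivative ?xx) (at x)"
    unfolding defs
    by (rule DERIV_cong[OF deriv], intro arg_cong2[where f = "(/)"])
       (simp_all add: field_simps power2_eq_square)
  moreover have "deriv (\<lambda>s. partial_x sn_graph (s, y)) x =
      deriv (\<lambda>s. - (\<alpha>' * sin (a * s) * cosh (a * y)) / sqrt (rad s y)) x"
    by (intro deriv_cong_ev eventually_mono[OF eventually_abs_cos_less_cosh(1)[OF assms(1)]])
       (simp_all add: partial_x_sn_graph)
  ultimately show "partial_x (partial_x sn_graph) (x, y) = ?xx"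
    unfolding partial_x_def[of "partial_x sn_graph"] by (simp only: DERIV_imp_deriv prod.case)
  have "((\<lambda>t. - (\<alpha>' * sin (a * x) * cosh (a * t))) has_real_derivative
      - (\<alpha>' * sin (a * x) * (a * sinh (a * y)))) (at y)"
    by (auto intro!: derivative_eq_intros)
  note deriv = DERIV_divide_sqrt[OF this DERIV_rad_y pos]
  have "((\<lambda>t. - (\<alpha>' * sin (a * x) * cosh (a * t)) / sqrt (rad x t)) has_real_derivative ?xy) (at y)"
    unfolding defs
    by (rule DERIV_cong[OF deriv], intro arg_cong2[where f = "(/)"])
       (simp_all add: field_simps power2_eq_square)
  moreover have "deriv (\<lambda>t. partial_x sn_graph (x, t)) y =
      deriv (\<lambda>t. - (\<alpha>' * sin (a * x) * cosh (a * t)) / sqrt (rad x t)) y"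
    by (intro deriv_cong_ev eventually_mono[OF eventually_abs_cos_less_cosh(2)[OF assms(1)]])
       (simp_all add: partial_x_sn_graph)
  ultimately show "partial_y (partial_x sn_graph) (x, y) = ?xy"
    unfolding partial_y_def[of "partial_x sn_graph"] by (simp only: DERIV_imp_deriv prod.case)
  have "((\<lambda>t. - (\<alpha>' * cos (a * x) * sinh (a * t))) has_real_derivative
      - (\<alpha>' * cos (a * x) * (a * cosh (a * y)))) (at y)"
    by (auto intro!: derivative_eq_intros)
  note deriv = DERIV_divide_sqrt[OF this DERIV_rad_y pos]
  have "((\<lambda>t. - (\<alpha>' * cos (a * x) * sinh (a * t)) / sqrt (rad x t)) has_real_derivative ?yy) (at y)"
    unfolding defs
    by (rule DERIV_cong[OF deriv], intro arg_cong2[where f = "(/)"])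
       (simp_all add: field_simps power2_eq_square)
  moreover have "deriv (\<lambda>t. partial_y sn_graph (x, t)) y =
      deriv (\<lambda>t. - (\<alpha>' * cos (a * x) * sinh (a * t)) / sqrt (rad x t)) y"
    by (intro deriv_cong_ev eventually_mono[OF eventually_abs_cos_less_cosh(2)[OF assms(1)]])
       (simp_all add: partial_y_sn_graph)
  ultimately show "partial_y (partial_y sn_graph) (x, y) = ?yy"
    unfolding partial_y_def[of "partial_y sn_graph"] by (simp only: DERIV_imp_deriv prod.case)
qed

section \<open>Space-likeness and the maximal surface equation\<close>

lemma space_like_sn_graph:
  assumes "\<bar>cos (a * x)\<bar> < cosh (a * y)"
  shows "space_like_at sn_graph (x, y)"
proof -
  let ?c = "cos (a * x)" and ?C = "cosh (a * y)"
  note pos = rad_pos[OF assms]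
  have "(partial_x sn_graph (x, y))\<^sup>2 + (partial_y sn_graph (x, y))\<^sup>2 =
      (1 - \<alpha>\<^sup>2) * ((sin (a * x) * ?C)\<^sup>2 + (?c * sinh (a * y))\<^sup>2) / rad x y"
    using pos unfolding partial_x_sn_graph[OF assms] partial_y_sn_graph[OF assms] alpha'_square[symmetric]
    by (simp add: power_divide power_mult_distrib add_divide_distrib algebra_simps)
  \<comment> \<open>With sin^2 = 1 - cos^2 and sinh^2 = cosh^2 - 1 the mixed products
    cancel.\<close>
  also have "(sin (a * x) * ?C)\<^sup>2 + (?c * sinh (a * y))\<^sup>2 = rad1 x y"
    by (simp add: rad1_def power_mult_distrib sin_squared_eq sinh_square_eq algebra_simps)
  also have "(1 - \<alpha>\<^sup>2) * rad1 x y / rad x y = (1 - \<alpha>\<^sup>2) / rad2 x y"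
    using pos by simp
  also have "\<dots> < 1"
  proof -
    \<comment> \<open>\<open>rad2 x y - (1 - \<alpha>\<^sup>2)\<close> is the sum of this positive
      quantity and the next, nonnegative one.\<close>
    have "0 < \<alpha>\<^sup>2 * rad1 x y" using \<alpha> pos by simp
    moreover have "0 \<le> (1 - \<alpha>\<^sup>2) * (?C\<^sup>2 - 1)"
      using \<alpha> cosh_real_ge_1[of "a * y"] by (intro mult_nonneg_nonneg) (auto simp: power_le_one)
    ultimately have "1 - \<alpha>\<^sup>2 < rad2 x y"
      by (simp add: rad1_def rad2_def algebra_simps)
    then show ?thesis using pos by simp
  qed
  finally show ?thesis
    by (simp add: space_like_at_def norm_Pair)
qed

lemma maximal_surface_sn_graph:
  assumes "\<bar>cos (a * x)\<bar> < cosh (a * y)"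
  shows "maximal_surface_eq_at sn_graph (x, y)"
proof -
  define A B c s C S where defs: "A = rad1 x y" "B = rad2 x y" "c = cos (a * x)" "s = sin (a * x)"
    "C = cosh (a * y)" "S = sinh (a * y)"
  define R where "R = sqrt (A * B)"
  have R: "0 < R" "R\<^sup>2 = A * B" using rad_pos[OF assms] by (auto simp: R_def defs)
  have AB: "A = C\<^sup>2 - c\<^sup>2" "B = C\<^sup>2 - \<alpha>\<^sup>2 * c\<^sup>2" and sS: "s\<^sup>2 = 1 - c\<^sup>2" "S\<^sup>2 = C\<^sup>2 - 1"
    by (simp_all add: defs rad1_def rad2_def sin_squared_eq sinh_square_eq)
  let ?E = "A * B - s\<^sup>2 * (B + \<alpha>\<^sup>2 * A)" and ?F = "A * B - C\<^sup>2 * (B + A)" and ?G = "A * B - S\<^sup>2 * (B + A)"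
  have "(1 - (partial_y sn_graph (x, y))\<^sup>2) * partial_x (partial_x sn_graph) (x, y)
     + 2 * partial_x sn_graph (x, y) * partial_y sn_graph (x, y) * partial_y (partial_x sn_graph) (x, y)
     + (1 - (partial_x sn_graph (x, y))\<^sup>2) * partial_y (partial_y sn_graph) (x, y) =
     (1 - (- (\<alpha>' * c * S) / R)\<^sup>2) * (- (\<alpha>' * a * c * C) * ?E / R ^ 3)
     + 2 * (- (\<alpha>' * s * C) / R) * (- (\<alpha>' * c * S) / R) * (- (\<alpha>' * a * s * S) * ?F / R ^ 3)
     + (1 - (- (\<alpha>' * s * C) / R)\<^sup>2) * (- (\<alpha>' * a * c * C) * ?G / R ^ 3)"
    unfolding partial_x_sn_graph[OF assms] partial_y_sn_graph[OF assms] second_partials_sn_graph[OF assms]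
    by (simp only: R_def defs)
  \<comment> \<open>Every summand carries this factor; in the middle one the remaining factors
    \<open>s\<close> and \<open>S\<close> occur twice each, so the bracket contains only
    squares.\<close>
  also have "\<dots> = - (\<alpha>' * a * c * C) / R ^ 5 *
     ((R\<^sup>2 - \<alpha>'\<^sup>2 * c\<^sup>2 * S\<^sup>2) * ?E + 2 * \<alpha>'\<^sup>2 * s\<^sup>2 * S\<^sup>2 * ?F + (R\<^sup>2 - \<alpha>'\<^sup>2 * s\<^sup>2 * C\<^sup>2) * ?G)"
    using R(1) by (simp add: field_simps power2_eq_square eval_nat_numeral)
  also have "(R\<^sup>2 - \<alpha>'\<^sup>2 * c\<^sup>2 * S\<^sup>2) * ?E + 2 * \<alpha>'\<^sup>2 * s\<^sup>2 * S\<^sup>2 * ?F + (R\<^sup>2 - \<alpha>'\<^sup>2 * s\<^sup>2 * C\<^sup>2) * ?G = 0"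
    using maximal_surface_polynomial_identity[of "C\<^sup>2" "c\<^sup>2" "\<alpha>\<^sup>2"]
    unfolding R alpha'_square sS AB by (simp add: ac_simps)
  finally show ?thesis
    by (simp add: maximal_surface_eq_at_def)
qed

section \<open>The graph as the unique solution of the implicit equation\<close>

lemma implicit_equation_iff:
  "\<bar>z\<bar> \<le> \<alpha>' / a * elliptic_K \<alpha> \<and> jacobi_sn (a * z / \<alpha>') \<alpha> = cos (a * x) / cosh (a * y)
     \<longleftrightarrow> z = sn_graph (x, y)"
proof -
  let ?w = "cos (a * x) / cosh (a * y)"
  have w: "\<bar>?w\<bar> \<le> 1"
    using order_trans[OF abs_cos_le_one cosh_real_ge_1] by (simp add: field_simps)
  have k: "0 \<le> \<alpha>" "\<alpha> < 1" using \<alpha> by auto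
  \<comment> \<open>After rescaling, the constraint on \<open>z\<close> is the interval on which sn
    inverts the elliptic integral.\<close>
  have scale: "\<bar>z\<bar> \<le> \<alpha>' / a * K \<longleftrightarrow> \<bar>a * z / \<alpha>'\<bar> \<le> K" for K
    using a alpha'_pos by (simp add: abs_mult field_simps)
  \<comment> \<open>By monotonicity the integral maps [-1, 1] into [-K, K], so the graph meets the
    constraint everywhere, including the singular set, where \<open>?w\<close> is 1 or -1.\<close>
  have "\<bar>elliptic_F ?w \<alpha>\<bar> \<le> elliptic_K \<alpha>"
  proof -
    have mono: "elliptic_F v \<alpha> \<le> elliptic_F w \<alpha>" if "-1 \<le> v" "v \<le> w" "w \<le> 1" for v w
      using elliptic_F_strict_mono[OF k, of v w] that by (cases "v = w") auto
    have "elliptic_F (-1) \<alpha> \<le> elliptic_F ?w \<alpha>"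
      using w by (intro mono) (auto simp only: abs_le_iff)
    moreover have "elliptic_F ?w \<alpha> \<le> elliptic_F 1 \<alpha>"
      using w by (intro mono) (auto simp only: abs_le_iff)
    ultimately show ?thesis by (simp add: elliptic_K_def elliptic_F_minus[OF k])
  qed
  moreover have "elliptic_F ?w \<alpha> = a * z / \<alpha>' \<longleftrightarrow> z = sn_graph (x, y)"
    using a alpha'_pos by (auto simp: sn_graph_def field_simps)
  ultimately show ?thesis
    unfolding scale using jacobi_sn_iff[OF k, of "a * z / \<alpha>'" ?w] w by metis
qed

end

theorem theorem3:
  fixes a \<alpha> \<alpha>' :: real
  assumes "0 < a" and "0 < \<alpha>" and "\<alpha> < 1" and "\<alpha>' = sqrt (1 - \<alpha>\<^sup>2)"
  shows "\<exists>u :: real \<times> real \<Rightarrow> real.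
      (\<forall>x y z. \<bar>z\<bar> \<le> \<alpha>' / a * elliptic_K \<alpha> \<and> jacobi_sn (a * z / \<alpha>') \<alpha> = cos (a * x) / cosh (a * y)
                \<longleftrightarrow> z = u (x, y)) \<and>
      real_analytic_on u (- singular_set a) \<and>
      (\<forall>p \<in> - singular_set a. space_like_at u p \<and> maximal_surface_eq_at u p)"
proof (intro exI[of _ "sn_graph a \<alpha> \<alpha>'"] conjI allI ballI)
  show "\<bar>z\<bar> \<le> \<alpha>' / a * elliptic_K \<alpha> \<and> jacobi_sn (a * z / \<alpha>') \<alpha> = cos (a * x) / cosh (a * y)
      \<longleftrightarrow> z = sn_graph a \<alpha> \<alpha>' (x, y)" for x y z
    by (rule implicit_equation_iff[OF assms])
  show "real_analytic_on (sn_graph a \<alpha> \<alpha>') (- singular_set a)"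
    unfolding real_analytic_on_def
  proof
    fix p assume "p \<in> - singular_set a"
    then have "\<bar>cos (a * fst p)\<bar> < cosh (a * snd p)"
      by (intro abs_cos_less_cosh assms) simp
    from real_analytic_at_scaled_elliptic_F[OF less_imp_le[OF assms(2)] assms(3) this, of "\<alpha>' / a"]
    show "real_analytic_at (sn_graph a \<alpha> \<alpha>') p"
      by (simp add: sn_graph_def[OF assms])
  qed
  fix p assume "p \<in> - singular_set a"
  then have "\<bar>cos (a * fst p)\<bar> < cosh (a * snd p)"
    by (intro abs_cos_less_cosh assms) simp
  then show "space_like_at (sn_graph a \<alpha> \<alpha>') p" "maximal_surface_eq_at (sn_graph a \<alpha> \<alpha>') p"
    using space_like_sn_graph[OF assms, of "fst p" "snd p"]
      maximal_surface_sn_graph[OF assms, of "fst p" "snd p"] by auto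
qed

end
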